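(* Let $G$ be a group acting transitively on a finite set $\Omega$, and let $A$ and $B$ be subgroups of $G$ such that $B \triangleleft A$. Let $\omega_1, \ldots, \omega_k \in \Omega$ with $k\geqslant 2$ be such that $\omega_i^B \neq \omega_j^B$ for $i \neq j$, and $\omega_1^A = \omega_1^B \cup \omega_2^B \cup \cdots \cup \omega_k^B$. Let $X \subset \Omega$ be a nonempty proper subset, and let $\Delta = \{Y \in X^G \mid Y \cap \omega_1^A \neq \varnothing\}$, where $X^G=\{X^g \mid g\in G\}$. If the orbits of $A$ and $B$ on $\Delta$ are the same, then the pair $(X,\ \Omega + k\omega_1^B - \omega_1^A)$ is a witness to $G$ being non-spreading on $\Omega$.
   Context: Multisets on $\Omega$ are identified with functions $\Omega\to\mathbb{Z}_{\ge 0}$ giving multiplicities, and a subset is identified with its characteristic function; $|X|$ is the sum of the multiplicities of $X$. For multisets $X,Y$, the multiset $X\star Y$ is defined by $(X\star Y)(i)=X(i)Y(i)$. A multiset is trivial if it is constant or if only one element has nonzero multiplicity; otherwise it is nontrivial (the same terminology applies to sets). The multiset $\Omega + k\omega_1^B - \omega_1^A$ is formed by adding and subtracting multiplicities, where $k\omega_1^B$ is the multiset in which each element of the $B$-orbit $\omega_1^B$ has multiplicity $k$ and all other elements have multiplicity $0$. A transitive permutation group $G$ on a finite set $\Omega$ is non-spreading if there exist a nontrivial set $Y\subseteq\Omega$ and a nontrivial multiset $Z$ on $\Omega$ such that $|Z|$ divides $|\Omega|$ and $|Z\star Y^g|$ is constant for all $g\in G$. Such a pair $(Y,Z)$ is called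 a witness to $G$ being non-spreading. For a subgroup $H\le G$ and $\omega\in\Omega$, $\omega^H$ denotes the $H$-orbit of $\omega$. *)

theory Defs
  imports "HOL-Algebra.Group_Action" "HOL-Library.Multiset"
begin

text \<open>
  A multiset on a finite set \<open>\<Omega>\<close> is a library multiset whose elements lie in \<open>\<Omega>\<close>; the multiplicity
  function is \<^const>\<open>count\<close>, \<open>|X|\<close> is \<^const>\<open>size\<close>, and a subset \<open>Y\<close> of \<open>\<Omega>\<close> is
  identified with \<open>mset_set Y\<close>.
\<close>

definition mset_star :: "'a multiset \<Rightarrow> 'a multiset \<Rightarrow> 'a multiset" (infixl "\<star>" 70) where
  "X \<star> Y = Abs_multiset (\<lambda>i. count X i * count Y i)"

lemma count_mset_star [simp]: "count (X \<star> Y) i = count X i * count Y i"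
proof -
  have "finite {i. 0 < count X i * count Y i}"
    by (rule finite_subset [OF _ finite_set_mset [of X]]) auto
  then show ?thesis
    by (simp add: mset_star_def)
qed

definition trivial_mset :: "'a set \<Rightarrow> 'a multiset \<Rightarrow> bool" where
  "trivial_mset \<Omega> Z \<longleftrightarrow>
     (\<exists>c. \<forall>x\<in>\<Omega>. count Z x = c) \<or> (\<exists>x\<in>\<Omega>. set_mset Z = {x})"

definition non_spreading_witness ::
    "('g, 'm) monoid_scheme \<Rightarrow> 'a set \<Rightarrow> ('g \<Rightarrow> 'a \<Rightarrow> 'a) \<Rightarrow> 'a set \<Rightarrow> 'a multiset \<Rightarrow> bool" where
  "non_spreading_witness G \<Omega> \<phi> Y Z \<longleftrightarrow>
     Y \<subseteq> \<Omega> \<and> \<not> trivial_mset \<Omega> (mset_set Y) \<and>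
     set_mset Z \<subseteq> \<Omega> \<and> \<not> trivial_mset \<Omega> Z \<and>
     size Z dvd card \<Omega> \<and>
     (\<exists>c. \<forall>g\<in>carrier G. size (Z \<star> mset_set (\<phi> g ` Y)) = c)"

definition non_spreading ::
    "('g, 'm) monoid_scheme \<Rightarrow> 'a set \<Rightarrow> ('g \<Rightarrow> 'a \<Rightarrow> 'a) \<Rightarrow> bool" where
  "non_spreading G \<Omega> \<phi> \<longleftrightarrow>
     finite \<Omega> \<and> transitive_action G \<Omega> \<phi> \<and> (\<exists>Y Z. non_spreading_witness G \<Omega> \<phi> Y Z)"

abbreviation sub_orbit ::
    "('g, 'm) monoid_scheme \<Rightarrow> ('g \<Rightarrow> 'a \<Rightarrow> 'a) \<Rightarrow> 'g set \<Rightarrow> 'a \<Rightarrow> 'a set" where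
  "sub_orbit G \<phi> H x \<equiv> orbit (G\<lparr>carrier := H\<rparr>) \<phi> x"

abbreviation set_action :: "('g \<Rightarrow> 'a \<Rightarrow> 'a) \<Rightarrow> 'g \<Rightarrow> 'a set \<Rightarrow> 'a set" where
  "set_action \<phi> \<equiv> (\<lambda>g Y. \<phi> g ` Y)"

end

theory Submission
  imports Defs
begin

text \<open>
  The elements of \<open>A\<close> permute the \<open>B\<close>-orbits inside \<open>\<omega>\<^sub>1\<^sup>A\<close> transitively, as \<open>B\<close> is normal in \<open>A\<close>.
  If \<open>Y\<close> is a translate of \<open>X\<close> meeting \<open>\<omega>\<^sub>1\<^sup>A\<close>, then every \<open>a \<in> A\<close> acts on \<open>Y\<close> like some
  \<open>b \<in> B\<close>, which preserves each \<open>B\<close>-orbit; hence \<open>Y\<close> meets all the \<open>k\<close> \<open>B\<close>-orbits in equally many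
  points. Thus \<open>|Y \<inter> \<omega>\<^sub>1\<^sup>A| = k |Y \<inter> \<omega>\<^sub>1\<^sup>B|\<close>, for every translate \<open>Y\<close> of \<open>X\<close> and for \<open>Y = \<Omega>\<close>. This
  gives the size conditions, and it is also what rules out the trivial cases.
\<close>

text \<open>Multiplying by the 0/1 multiplicities of \<open>Y\<close> commutes with truncated
  subtraction. The product thus has the shape of the original multiset, with \<open>Y\<close>,
  \<open>Y \<inter> P\<close>, \<open>Y \<inter> Q\<close> for \<open>E\<close>, \<open>P\<close>,
  \<open>Q\<close>, so one size formula serves both.\<close>

lemma mset_star_swap_mset_set:
  assumes "finite E" "P \<subseteq> Q" "Q \<subseteq> E" "Y \<subseteq> E"
  shows "(mset_set E + repeat_mset k (mset_set P) - mset_set Q) \<star> mset_set Y =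
         mset_set Y + repeat_mset k (mset_set (Y \<inter> P)) - mset_set (Y \<inter> Q)"
proof -
  have "finite P" "finite Q" "finite Y"
    using assms by (auto intro: finite_subset)
  then show ?thesis
    using assms(1) subsetD[OF assms(2)] subsetD[OF assms(3)] subsetD[OF assms(4)]
    by (intro multiset_eqI) (auto simp: count_mset_set')
qed

text \<open>Since \<open>Q \<subseteq> E\<close>, the difference never truncates and sizes subtract;
  the \<open>k * card P\<close> added and the \<open>card Q\<close> removed cancel.\<close>

lemma size_swap_mset_set:
  assumes "finite E" "Q \<subseteq> E" "card Q = k * card P"
  shows "size (mset_set E + repeat_mset k (mset_set P) - mset_set Q) = card E"
proof -
  have "mset_set Q \<subseteq># mset_set E"
    using assms by (simp add: subset_imp_msubset_mset_set)
  then have "mset_set Q \<subseteq># mset_set E + repeat_mset k (mset_set P)"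
    by (rule subset_mset.add_increasing2[rotated]) simp
  then show ?thesis
    using assms by (simp add: size_Diff_submset)
qed

context group_action
begin

lemma sub_orbit_subset:
  assumes "subgroup H G" "x \<in> E"
  shows "sub_orbit G \<phi> H x \<subseteq> E"
  using assms by (auto simp: orbit_def dest: subgroup.mem_carrier intro: element_image)

lemma sub_orbit_eq_or_disjoint:
  assumes "subgroup H G" "x \<in> E" "y \<in> E"
  shows "sub_orbit G \<phi> H x = sub_orbit G \<phi> H y \<or> sub_orbit G \<phi> H x \<inter> sub_orbit G \<phi> H y = {}"
proof -
  interpret H: group_action "G\<lparr>carrier := H\<rparr>" E \<phi>
    using assms(1) by (rule induced_action)
  show ?thesis
    using assms by (intro H.disjoint_union) (auto simp: orbits_def)
qed

lemma image_inv_cancel: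
  assumes "g \<in> carrier G" "Y \<subseteq> E"
  shows "\<phi> (inv g) ` \<phi> g ` Y = Y"
proof -
  have "\<phi> (inv g) (\<phi> g x) = x" if "x \<in> Y" for x
    using that assms orbit_sym_aux by blast
  then show ?thesis
    by (simp add: image_image)
qed

lemma image_mult:
  assumes "g \<in> carrier G" "h \<in> carrier G" "Y \<subseteq> E"
  shows "\<phi> (g \<otimes> h) ` Y = \<phi> g ` \<phi> h ` Y"
proof -
  have "\<phi> (g \<otimes> h) x = \<phi> g (\<phi> h x)" if "x \<in> Y" for x
    using that assms composition_rule by blast
  then show ?thesis
    by (simp add: image_image)
qed

lemma card_image_action:
  assumes "g \<in> carrier G" "Y \<subseteq> E"
  shows "card (\<phi> g ` Y) = card Y"
  using assms by (meson card_image inj_on_subset inj_prop)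

lemma image_Int_action:
  assumes "g \<in> carrier G" "Y \<subseteq> E" "Z \<subseteq> E"
  shows "\<phi> g ` (Y \<inter> Z) = \<phi> g ` Y \<inter> \<phi> g ` Z"
  using assms by (meson inj_on_image_Int inj_prop)

text \<open>Normality gives aB = Ba, hence a(Bx) = (aB)x = (Ba)x = B(ax): elements of
  \<open>A\<close> permute the \<open>B\<close>-orbits.\<close>

lemma image_sub_orbit:
  assumes "subgroup A G" "subgroup B G" "B \<lhd> G\<lparr>carrier := A\<rparr>" "a \<in> A" "x \<in> E"
  shows "\<phi> a ` sub_orbit G \<phi> B x = sub_orbit G \<phi> B (\<phi> a x)"
proof -
  note carr = subgroup.mem_carrier[OF assms(1)] subgroup.mem_carrier[OF assms(2)]
  have coset: "(\<lambda>b. b \<otimes> a) ` B = (\<lambda>b. a \<otimes> b) ` B"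
    using normal.coset_eq[OF assms(3)] assms(4)
    by (simp add: r_coset_def l_coset_def UNION_singleton_eq_range)
  have "\<phi> a ` sub_orbit G \<phi> B x = (\<lambda>c. \<phi> c x) ` (\<lambda>b. a \<otimes> b) ` B"
    using assms carr by (force simp: orbit_def composition_rule)
  also have "\<dots> = sub_orbit G \<phi> B (\<phi> a x)"
    unfolding coset[symmetric] using assms carr by (force simp: orbit_def composition_rule)
  finally show ?thesis .
qed

lemma image_sub_orbit_self:
  assumes "subgroup B G" "b \<in> B" "x \<in> E"
  shows "\<phi> b ` sub_orbit G \<phi> B x = sub_orbit G \<phi> B x"
proof -
  interpret B: group_action "G\<lparr>carrier := B\<rparr>" E \<phi>
    using assms(1) by (rule induced_action)
  interpret G: group G
    using group_hom group_hom.axioms(1) by auto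
  have bx: "\<phi> b x \<in> E"
    using assms subgroup.mem_carrier element_image by metis
  have "\<phi> b x \<in> sub_orbit G \<phi> B x" "\<phi> b x \<in> sub_orbit G \<phi> B (\<phi> b x)"
    using assms B.orbit_refl[OF bx] by (auto simp: orbit_def)
  then have "sub_orbit G \<phi> B (\<phi> b x) = sub_orbit G \<phi> B x"
    using sub_orbit_eq_or_disjoint[OF assms(1) bx assms(3)] by blast
  \<comment> \<open>With \<open>B\<close> normal in itself, \<open>image_sub_orbit\<close> can be
    applied with \<open>B\<close> in the role of \<open>A\<close>.\<close>
  moreover have "B \<lhd> G\<lparr>carrier := B\<rparr>"
  proof -
    interpret GB: group "G\<lparr>carrier := B\<rparr>"
      using assms(1) by (rule G.subgroup_imp_group)
    have "carrier (G\<lparr>carrier := B\<rparr>) \<lhd> G\<lparr>carrier := B\<rparr>"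
      using GB.normal_inv_iff GB.subgroup_self GB.inv_closed GB.m_closed by blast
    then show ?thesis by simp
  qed
  ultimately show ?thesis
    using image_sub_orbit[OF assms(1,1) _ assms(2,3)] by simp
qed

text \<open>The inverse of \<open>a\<close> carries the \<open>B\<close>-orbit of
  \<open>\<phi> a x\<close> to that of \<open>x\<close>, and it moves \<open>Y\<close> as some
  \<open>b \<in> B\<close> does. As \<open>b\<close> preserves the \<open>B\<close>-orbit of
  \<open>x\<close>, both intersections have the same image, one under \<open>inv a\<close> and the
  other under \<open>b\<close>, and both maps are injective.\<close>

lemma card_Int_sub_orbit_translate:
  assumes A: "subgroup A G" and B: "subgroup B G" and BA: "B \<lhd> G\<lparr>carrier := A\<rparr>"
    and Y: "Y \<subseteq> E" "\<And>a. a \<in> A \<Longrightarrow> \<exists>b\<in>B. \<phi> a ` Y = \<phi> b ` Y"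
    and "a \<in> A" "x \<in> E"
  shows "card (Y \<inter> sub_orbit G \<phi> B (\<phi> a x)) = card (Y \<inter> sub_orbit G \<phi> B x)"
proof -
  have inv_a: "inv a \<in> A"
    using A \<open>a \<in> A\<close> by (rule subgroup.m_inv_closed)
  then obtain b where b: "b \<in> B" "\<phi> (inv a) ` Y = \<phi> b ` Y"
    using Y(2) by blast
  have carr: "a \<in> carrier G" "inv a \<in> carrier G" "b \<in> carrier G"
    using A B \<open>a \<in> A\<close> inv_a b(1) by (auto dest: subgroup.mem_carrier)
  have ax: "\<phi> a x \<in> E"
    using carr(1) \<open>x \<in> E\<close> element_image by blast
  have "\<phi> (inv a) ` (Y \<inter> sub_orbit G \<phi> B (\<phi> a x)) = \<phi> b ` Y \<inter> sub_orbit G \<phi> B x"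
    using image_Int_action[OF carr(2) Y(1) sub_orbit_subset[OF B ax]]
      image_sub_orbit[OF A B BA inv_a ax] orbit_sym_aux[OF carr(1) \<open>x \<in> E\<close> refl] b(2)
    by simp
  also have "\<dots> = \<phi> b ` (Y \<inter> sub_orbit G \<phi> B x)"
    using image_Int_action[OF carr(3) Y(1) sub_orbit_subset[OF B \<open>x \<in> E\<close>]]
      image_sub_orbit_self[OF B b(1) \<open>x \<in> E\<close>] by simp
  finally have "card (\<phi> (inv a) ` (Y \<inter> sub_orbit G \<phi> B (\<phi> a x))) =
      card (\<phi> b ` (Y \<inter> sub_orbit G \<phi> B x))"
    by simp
  then show ?thesis
    using Y(1) carr by (simp add: card_image_action le_infI1)
qed

text \<open>Each \<open>w i\<close> lies in the \<open>A\<close>-orbit of \<open>x\<close>, so by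
  the translation lemma \<open>Y\<close> meets its \<open>B\<close>-orbit in as many points as that
  of \<open>x\<close>. Distinct \<open>B\<close>-orbits are disjoint, so these counts add
  up.\<close>

lemma card_Int_sub_orbit_Union:
  assumes "finite E" and A: "subgroup A G" and B: "subgroup B G"
    and BA: "B \<lhd> G\<lparr>carrier := A\<rparr>"
    and Y: "Y \<subseteq> E" "\<And>a. a \<in> A \<Longrightarrow> \<exists>b\<in>B. \<phi> a ` Y = \<phi> b ` Y"
    and "finite I" "x \<in> E" and w: "\<And>i. i \<in> I \<Longrightarrow> w i \<in> E"
    and neq: "\<And>i j. i \<in> I \<Longrightarrow> j \<in> I \<Longrightarrow> i \<noteq> j \<Longrightarrow>
           sub_orbit G \<phi> B (w i) \<noteq> sub_orbit G \<phi> B (w j)"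
    and U: "sub_orbit G \<phi> A x = (\<Union>i\<in>I. sub_orbit G \<phi> B (w i))"
  shows "card (Y \<inter> sub_orbit G \<phi> A x) = card I * card (Y \<inter> sub_orbit G \<phi> B x)"
proof -
  interpret B: group_action "G\<lparr>carrier := B\<rparr>" E \<phi>
    using B by (rule induced_action)
  have fin: "finite Y"
    using Y(1) \<open>finite E\<close> by (rule finite_subset)
  have part: "card (Y \<inter> sub_orbit G \<phi> B (w i)) = card (Y \<inter> sub_orbit G \<phi> B x)" if "i \<in> I" for i
  proof -
    have "w i \<in> sub_orbit G \<phi> A x"
      using U B.orbit_refl[OF w[OF that]] that by blast
    then obtain a where "a \<in> A" "w i = \<phi> a x"
      by (auto simp: orbit_def)
    then show ?thesis
      using card_Int_sub_orbit_translate[OF A B BA Y _ \<open>x \<in> E\<close>] by simp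
  qed
  have "card (Y \<inter> sub_orbit G \<phi> A x) = card (\<Union>i\<in>I. Y \<inter> sub_orbit G \<phi> B (w i))"
    unfolding U by simp
  also have "\<dots> = (\<Sum>i\<in>I. card (Y \<inter> sub_orbit G \<phi> B (w i)))"
  proof (rule card_UN_disjoint)
    have "(Y \<inter> sub_orbit G \<phi> B (w i)) \<inter> (Y \<inter> sub_orbit G \<phi> B (w j)) = {}"
      if "i \<in> I" "j \<in> I" "i \<noteq> j" for i j
      using sub_orbit_eq_or_disjoint[OF B w[OF that(1)] w[OF that(2)]] neq[OF that] by blast
    then show "\<forall>i\<in>I. \<forall>j\<in>I. i \<noteq> j \<longrightarrow>
        (Y \<inter> sub_orbit G \<phi> B (w i)) \<inter> (Y \<inter> sub_orbit G \<phi> B (w j)) = {}"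
      by simp
  qed (use \<open>finite I\<close> fin in simp_all)
  also have "\<dots> = card I * card (Y \<inter> sub_orbit G \<phi> B x)"
    using part by simp
  finally show ?thesis .
qed

text \<open>The hypothesis compares families of orbits, so the \<open>A\<close>-orbit of
  \<open>Y\<close> is the \<open>B\<close>-orbit of some \<open>Y'\<close>, not visibly of
  \<open>Y\<close>. Both \<open>Y\<close> and its image under \<open>a\<close> lie in it, say as bY'
  and cY'; then c times the inverse of b is the required element.\<close>

lemma orbits_eq_imp_same_image:
  assumes A: "subgroup A G" and B: "subgroup B G" and \<D>: "\<D> \<subseteq> Pow E"
    and eq: "orbits (G\<lparr>carrier := A\<rparr>) \<D> (set_action \<phi>) = orbits (G\<lparr>carrier := B\<rparr>) \<D> (set_action \<phi>)"
    and "Y \<in> \<D>" "a \<in> A"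
  shows "\<exists>b\<in>B. \<phi> a ` Y = \<phi> b ` Y"
proof -
  interpret G: group G
    using group_hom group_hom.axioms(1) by auto
  have "orbit (G\<lparr>carrier := A\<rparr>) (set_action \<phi>) Y \<in> orbits (G\<lparr>carrier := B\<rparr>) \<D> (set_action \<phi>)"
    using eq \<open>Y \<in> \<D>\<close> by (auto simp: orbits_def)
  then obtain Y' where Y': "Y' \<in> \<D>"
    "orbit (G\<lparr>carrier := A\<rparr>) (set_action \<phi>) Y = orbit (G\<lparr>carrier := B\<rparr>) (set_action \<phi>) Y'"
    by (auto simp: orbits_def)
  have sub: "Y \<subseteq> E" "Y' \<subseteq> E"
    using \<D> \<open>Y \<in> \<D>\<close> Y'(1) by auto
  have "\<phi> \<one> ` Y = Y"
    using sub(1) by (force simp: id_eq_one[symmetric])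
  then have "Y \<in> orbit (G\<lparr>carrier := A\<rparr>) (set_action \<phi>) Y"
    "\<phi> a ` Y \<in> orbit (G\<lparr>carrier := A\<rparr>) (set_action \<phi>) Y"
    using subgroup.one_closed[OF A] \<open>a \<in> A\<close> by (force simp: orbit_def)+
  then obtain b c where bc: "b \<in> B" "Y = \<phi> b ` Y'" "c \<in> B" "\<phi> a ` Y = \<phi> c ` Y'"
    unfolding Y'(2) by (auto simp: orbit_def)
  have carr: "b \<in> carrier G" "c \<in> carrier G"
    using bc B by (auto dest: subgroup.mem_carrier)
  have "\<phi> a ` Y = \<phi> (c \<otimes> inv b) ` Y"
    using bc(4) carr image_mult[OF carr(2) _ sub(1), of "inv b"]
      image_inv_cancel[OF carr(1) sub(2)] bc(2) by simp
  then show ?thesis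
    using bc B by (blast intro: subgroup.m_closed subgroup.m_inv_closed)
qed

end

theorem theorem2p2:
  fixes G :: "('g, 'm) monoid_scheme"
    and \<Omega> :: "'a set"
    and \<phi> :: "'g \<Rightarrow> 'a \<Rightarrow> 'a"
    and A B :: "'g set"
    and k :: nat
    and \<omega> :: "nat \<Rightarrow> 'a"
    and X :: "'a set"
    and \<Delta> :: "'a set set"
  assumes "finite \<Omega>"
    and "transitive_action G \<Omega> \<phi>"
    and "subgroup A G"
    and "subgroup B G"
    and "B \<lhd> (G\<lparr>carrier := A\<rparr>)"
    and "k \<ge> 2"
    and "\<And>i. i \<in> {1..k} \<Longrightarrow> \<omega> i \<in> \<Omega>"
    and "\<And>i j. i \<in> {1..k} \<Longrightarrow> j \<in> {1..k} \<Longrightarrow> i \<noteq> j \<Longrightarrow>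
           sub_orbit G \<phi> B (\<omega> i) \<noteq> sub_orbit G \<phi> B (\<omega> j)"
    and "sub_orbit G \<phi> A (\<omega> 1) = (\<Union>i\<in>{1..k}. sub_orbit G \<phi> B (\<omega> i))"
    and "X \<noteq> {}"
    and "X \<subset> \<Omega>"
    and "\<Delta> = {Y \<in> orbit G (set_action \<phi>) X. Y \<inter> sub_orbit G \<phi> A (\<omega> 1) \<noteq> {}}"
    and "orbits (G\<lparr>carrier := A\<rparr>) \<Delta> (set_action \<phi>) = orbits (G\<lparr>carrier := B\<rparr>) \<Delta> (set_action \<phi>)"
  shows "non_spreading_witness G \<Omega> \<phi> X
           (mset_set \<Omega> + repeat_mset k (mset_set (sub_orbit G \<phi> B (\<omega> 1)))
             - mset_set (sub_orbit G \<phi> A (\<omega> 1)))"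
proof -
  interpret transitive_action G \<Omega> \<phi> by (rule assms(2))
  define OA OB where "OA = sub_orbit G \<phi> A (\<omega> 1)" and "OB = sub_orbit G \<phi> B (\<omega> 1)"
  define Z where "Z = mset_set \<Omega> + repeat_mset k (mset_set OB) - mset_set OA"
  note fin = assms(1) and A = assms(3) and B = assms(4) and k = assms(6)
  interpret B: group_action "G\<lparr>carrier := B\<rparr>" \<Omega> \<phi>
    using B by (rule induced_action)
  have w: "\<omega> 1 \<in> \<Omega>" "\<omega> 2 \<in> \<Omega>"
    using k assms(7) by auto
  have OA: "OA \<subseteq> \<Omega>" and OB: "OB \<subseteq> OA"
    using sub_orbit_subset[OF A w(1)] assms(9) k by (auto simp: OA_def OB_def)
  have finO: "finite OA" "finite OB"
    using fin OA OB by (auto intro: finite_subset)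
  have w1: "\<omega> 1 \<in> OB"
    using B.orbit_refl[OF w(1)] by (simp add: OB_def)
  have w2: "\<omega> 2 \<in> OA"
    using B.orbit_refl[OF w(2)] assms(9) k by (auto simp: OA_def)
  \<comment> \<open>This is where \<open>k \<ge> 2\<close> supplies a point of
    \<open>OA - OB\<close>. There \<open>Z\<close> has multiplicity 0, against \<open>k\<close> at
    \<open>\<omega> 1\<close>, so \<open>Z\<close> is not constant.\<close>
  have w2': "\<omega> 2 \<notin> OB"
    using sub_orbit_eq_or_disjoint[OF B w] assms(8)[of 1 2] k B.orbit_refl[OF w(2)]
    by (auto simp: OB_def)
  have count_Z: "count Z x = (if x \<in> OB then k else if x \<in> \<Omega> - OA then 1 else 0)" for x
    using fin finO OA OB by (auto simp: Z_def count_mset_set')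
  have card_k: "card (Y \<inter> OA) = k * card (Y \<inter> OB)"
    if "Y \<subseteq> \<Omega>" "\<And>a. a \<in> A \<Longrightarrow> \<exists>b\<in>B. \<phi> a ` Y = \<phi> b ` Y" for Y
    using card_Int_sub_orbit_Union[OF fin A B assms(5) that _ w(1) assms(7,8,9)]
    by (simp add: OA_def OB_def)
  \<comment> \<open>Every group element maps \<open>\<Omega>\<close> onto itself, so the identity
    serves as \<open>b\<close>, and \<open>card_k\<close> covers \<open>\<Omega>\<close>
    too.\<close>
  have "\<exists>b\<in>B. \<phi> a ` \<Omega> = \<phi> b ` \<Omega>" if "a \<in> A" for a
    using surj_prop subgroup.mem_carrier[OF A that] subgroup.mem_carrier[OF B]
      subgroup.one_closed[OF B] by metis
  then have card_OA: "card OA = k * card OB"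
    using card_k[of \<Omega>] OA OB by (simp add: Int_absorb1)
  have sub: "\<phi> g ` X \<subseteq> \<Omega>" if "g \<in> carrier G" for g
    using surj_prop[OF that] assms(11) by blast
  have card_X: "card (\<phi> g ` X \<inter> OA) = k * card (\<phi> g ` X \<inter> OB)" if g: "g \<in> carrier G" for g
  proof (cases "\<phi> g ` X \<inter> OA = {}")
    case True
    then have "\<phi> g ` X \<inter> OB = {}"
      using OB by blast
    with True show ?thesis by simp
  next
    case False
    then have "\<phi> g ` X \<in> \<Delta>"
      using g by (auto simp: assms(12) OA_def orbit_def)
    moreover have "\<Delta> \<subseteq> Pow \<Omega>"
      using sub by (auto simp: assms(12) orbit_def)
    ultimately show ?thesis
      using card_k[OF sub[OF g]] orbits_eq_imp_same_image[OF A B _ assms(13)] by simp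
  qed
  have finX: "finite X"
    using fin assms(11) by (auto intro: finite_subset)
  have "\<not> trivial_mset \<Omega> (mset_set X)"
  proof
    assume "trivial_mset \<Omega> (mset_set X)"
    then consider c where "\<forall>x\<in>\<Omega>. count (mset_set X) x = c" | x where "X = {x}"
      using finX by (auto simp: trivial_mset_def)
    then show False
    proof cases
      case 1
      obtain x y where "x \<in> X" "y \<in> \<Omega> - X"
        using assms(10,11) by blast
      then show False
        using 1 finX assms(11) by (auto simp: count_mset_set' split: if_splits)
    next
      case 2
      \<comment> \<open>Moving the single point of \<open>X\<close> to \<open>\<omega> 1\<close>
        gives a translate meeting both \<open>OA\<close> and \<open>OB\<close> in one point, so
        \<open>card_X\<close> would read 1 = k.\<close>
      then obtain g where "g \<in> carrier G" "\<phi> g x = \<omega> 1"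
        using unique_orbit[of x "\<omega> 1"] assms(11) w(1) by auto
      then show False
        using card_X[of g] 2 w1 OB k by auto
    qed
  qed
  moreover have "\<not> trivial_mset \<Omega> Z"
  proof
    assume "trivial_mset \<Omega> Z"
    then consider c where "\<forall>x\<in>\<Omega>. count Z x = c" | x where "set_mset Z = {x}"
      by (auto simp: trivial_mset_def)
    then show False
    proof cases
      case 1
      then have "count Z (\<omega> 1) = count Z (\<omega> 2)"
        using w by simp
      then show False
        using w1 w2 w2' k by (simp add: count_Z)
    next
      case 2
      \<comment> \<open>The support of \<open>Z\<close> is \<open>OB\<close> together with the
        complement of \<open>OA\<close>. If it is one point, that point is
        \<open>\<omega> 1\<close>, which forces \<open>OB = {\<omega> 1}\<close> and
        \<open>OA = \<Omega>\<close>.\<close>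
      have "OB \<union> (\<Omega> - OA) = set_mset Z"
        using k by (auto simp: count_Z set_mset_def split: if_splits)
      then have "OB \<union> (\<Omega> - OA) = {x}"
        using 2 by simp
      then have *: "OB \<subseteq> {x}" "\<Omega> - OA \<subseteq> {x}"
        by (metis Un_upper1, metis Un_upper2)
      then have "\<omega> 1 = x"
        using w1 by (metis subsetD singletonD)
      then have "OB = {\<omega> 1}"
        using * w1 by (metis empty_iff subset_singletonD)
      have "\<Omega> \<subseteq> OA"
        using *(2) w1 OB \<open>\<omega> 1 = x\<close> by (metis DiffI subsetI subsetD singletonD)
      with OA have "OA = \<Omega>"
        by (rule subset_antisym)
      \<comment> \<open>A point outside \<open>X\<close> is moved to \<open>\<omega> 1\<close>, so
        the translate of \<open>X\<close> misses \<open>OB\<close>. By \<open>card_X\<close> it then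
        misses \<open>OA = \<Omega>\<close> as well, although \<open>X\<close> is nonempty.\<close>
      obtain y where y: "y \<in> \<Omega> - X"
        using assms(11) by blast
      then obtain g where g: "g \<in> carrier G" "\<phi> g y = \<omega> 1"
        using unique_orbit[of y "\<omega> 1"] w(1) by auto
      have "\<omega> 1 \<notin> \<phi> g ` X"
        using inj_onD[OF inj_prop[OF g(1)], of y] g(2) y assms(11) by auto
      then have "card (\<phi> g ` X) = 0"
        using card_X[OF g(1)] sub[OF g(1)] \<open>OB = {\<omega> 1}\<close> \<open>OA = \<Omega>\<close> by (simp add: Int_absorb2)
      then show False
        using finX assms(10) by simp
    qed
  qed
  moreover have "set_mset Z \<subseteq> \<Omega>"
    using OA OB by (auto simp: count_Z simp flip: count_greater_zero_iff split: if_splits)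
  moreover have "size Z = card \<Omega>"
    unfolding Z_def using fin OA card_OA by (rule size_swap_mset_set)
  moreover have "size (Z \<star> mset_set (\<phi> g ` X)) = card X" if g: "g \<in> carrier G" for g
  proof -
    \<comment> \<open>After the rewriting, \<open>card_X\<close> is exactly the cardinality
      condition of \<open>size_swap_mset_set\<close> for the translate of \<open>X\<close>.\<close>
    have "size (Z \<star> mset_set (\<phi> g ` X)) = card (\<phi> g ` X)"
      unfolding Z_def mset_star_swap_mset_set[OF fin OB OA sub[OF g]]
      using finX card_X[OF g] by (intro size_swap_mset_set) auto
    also have "\<dots> = card X"
      using card_image_action[OF g] assms(11) by blast
    finally show ?thesis .
  qed
  ultimately show ?thesis
    using assms(11) unfolding non_spreading_witness_def Z_def OA_def OB_def by auto
qed

end
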